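(* For every rational number $p/q$ with $9/10 \le p/q < 1$, there exist infinitely many cyclically $4$-connected cubic graphs $G$ of girth $5$ such that $m_3(G) = p/q$.
   Context: For a bridgeless cubic graph $G$, $m_3(G)$ denotes the maximum, over all choices of three perfect matchings $M_1, M_2, M_3$ of $G$, of $|M_1\cup M_2\cup M_3|$, divided by $|E(G)|$. A graph is cyclically $k$-connected if no set of fewer than $k$ edges is cycle-separating, i.e. its removal never leaves two components each containing a cycle. *)

theory Defs
  imports Complex_Main "HOL-Library.Extended_Nat"
begin

text \<open>Finite simple graphs on vertex set V (vertices are naturals), edges are 2-element sets.
  Girth 5 forces simplicity, so simple graphs suffice.\<close>

definition simple_graph :: "nat set \<Rightarrow> nat set set \<Rightarrow> bool" where
  "simple_graph V E \<longleftrightarrow> finite V \<and>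
     (\<forall>e\<in>E. \<exists>u v. u \<noteq> v \<and> u \<in> V \<and> v \<in> V \<and> e = {u, v})"

definition degree :: "nat set set \<Rightarrow> nat \<Rightarrow> nat" where
  "degree E v = card {e \<in> E. v \<in> e}"

definition cubic_graph :: "nat set \<Rightarrow> nat set set \<Rightarrow> bool" where
  "cubic_graph V E \<longleftrightarrow> simple_graph V E \<and> (\<forall>v\<in>V. degree E v = 3)"

definition perfect_matching :: "nat set \<Rightarrow> nat set set \<Rightarrow> nat set set \<Rightarrow> bool" where
  "perfect_matching V E M \<longleftrightarrow> M \<subseteq> E \<and> (\<forall>v\<in>V. card {e \<in> M. v \<in> e} = 1)"

definition reach :: "nat set set \<Rightarrow> nat \<Rightarrow> nat \<Rightarrow> bool" where
  "reach E = (\<lambda>u v. {u, v} \<in> E)\<^sup>*\<^sup>*"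

definition bridgeless :: "nat set \<Rightarrow> nat set set \<Rightarrow> bool" where
  "bridgeless V E \<longleftrightarrow> (\<forall>u v. {u, v} \<in> E \<longrightarrow> reach (E - {{u, v}}) u v)"

definition is_cycle :: "nat set \<Rightarrow> nat set set \<Rightarrow> nat list \<Rightarrow> bool" where
  "is_cycle V E xs \<longleftrightarrow> length xs \<ge> 3 \<and> distinct xs \<and> set xs \<subseteq> V \<and>
     (\<forall>i < length xs. {xs ! i, xs ! ((i + 1) mod length xs)} \<in> E)"

definition girth :: "nat set \<Rightarrow> nat set set \<Rightarrow> enat" where
  "girth V E = (INF xs \<in> {xs. is_cycle V E xs}. enat (length xs))"

definition components :: "nat set \<Rightarrow> nat set set \<Rightarrow> nat set set" where
  "components V E = {{w \<in> V. reach E u w} | u. u \<in> V}"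

definition component_has_cycle :: "nat set \<Rightarrow> nat set set \<Rightarrow> nat set \<Rightarrow> bool" where
  "component_has_cycle V E C \<longleftrightarrow> (\<exists>xs. is_cycle V E xs \<and> set xs \<subseteq> C)"

definition cycle_separating :: "nat set \<Rightarrow> nat set set \<Rightarrow> nat set set \<Rightarrow> bool" where
  "cycle_separating V E F \<longleftrightarrow> F \<subseteq> E \<and>
     (\<exists>C1 C2. C1 \<in> components V (E - F) \<and> C2 \<in> components V (E - F) \<and> C1 \<noteq> C2 \<and>
        component_has_cycle V (E - F) C1 \<and> component_has_cycle V (E - F) C2)"

definition cyclically_connected :: "nat \<Rightarrow> nat set \<Rightarrow> nat set set \<Rightarrow> bool" where
  "cyclically_connected k V E \<longleftrightarrow>
     (\<forall>F. F \<subseteq> E \<and> card F < k \<longrightarrow> \<not> cycle_separating V E F)"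

definition m3 :: "nat set \<Rightarrow> nat set set \<Rightarrow> real" where
  "m3 V E = real (Max {card (M1 \<union> M2 \<union> M3) | M1 M2 M3.
      perfect_matching V E M1 \<and> perfect_matching V E M2 \<and> perfect_matching V E M3})
    / real (card E)"

definition graph_iso :: "nat set \<times> nat set set \<Rightarrow> nat set \<times> nat set set \<Rightarrow> bool" where
  "graph_iso G H \<longleftrightarrow> (\<exists>f. bij_betw f (fst G) (fst H) \<and>
     (\<forall>u\<in>fst G. \<forall>v\<in>fst G. {u, v} \<in> snd G \<longleftrightarrow> {f u, f v} \<in> snd H))"

end

theory Submission
  imports Defs "HOL-Library.Nat_Bijection"
begin

text \<open>
  The graphs are rings of blocks of two kinds, consecutive blocks being joined by two edges.
  An I-block is the Petersen graph minus two adjacent vertices; an H-block is the Petersen graph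
  with two edges at maximal distance cut in half. In a 3-edge-colouring the two edges leaving an
  I-block on either side have equal colours, whereas those leaving an H-block on either side have
  different colours, so an H-block between two I-blocks is a local obstruction. Quantitatively, such
  an H-block always costs three edges not covered by three given perfect matchings: a potential on the
  possible states of the two edges between consecutive blocks lets an I-block share its own uncovered
  edges with its two neighbours, and both local inequalities are finite checks. Three explicit
  matchings attain this bound. With \<^term>\<open>4 * r * k\<close> H-blocks among \<^term>\<open>p * k\<close> blocks, where
  \<^term>\<open>r = q - p\<close>, there are \<^term>\<open>12 * q * k\<close> edges, exactly \<^term>\<open>12 * r * k\<close> of them uncovered; the
  blocks can be placed in this way because \<^term>\<open>9 * r \<le> p\<close>.

  Every edge cut through a block costs at least two edges, so a cut of at most three edges meets only one
  block and can be examined there.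
\<close>

section \<open>Connectivity from edge cuts\<close>

definition edge_cut :: "nat set set \<Rightarrow> nat set \<Rightarrow> nat set set" where
  "edge_cut E S = {e \<in> E. \<not> e \<subseteq> S \<and> e \<inter> S \<noteq> {}}"

lemma reach_sym: "reach E u v \<Longrightarrow> reach E v u"
  unfolding reach_def
  by (rule sympD[OF symp_rtranclp]) (auto simp: symp_def insert_commute)

text \<open>An edge outside \<open>F\<close> with one end in the component would carry reachability
  over to its other end.\<close>

lemma cut_component_subset:
  assumes "simple_graph V E"
  shows "edge_cut E {w \<in> V. reach (E - F) u w} \<subseteq> F"
proof
  fix e assume e: "e \<in> edge_cut E {w \<in> V. reach (E - F) u w}"
  then obtain x y where xy: "e = {x, y}" "x \<in> V" "y \<in> V" "e \<in> E"
    using assms unfolding edge_cut_def simple_graph_def by blast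
  have step: "reach (E - F) u b" if "reach (E - F) u a" "{a, b} \<in> E - F" for a b
    using that unfolding reach_def by (rule rtranclp.rtrancl_into_rtrancl)
  show "e \<in> F"
  proof (rule ccontr)
    assume "e \<notin> F"
    then have "{x, y} \<in> E - F" "{y, x} \<in> E - F" using xy by (auto simp: insert_commute)
    moreover have "(reach (E - F) u x) \<noteq> (reach (E - F) u y)"
      using e xy(2,3) unfolding edge_cut_def xy(1) by blast
    ultimately show False using step[of x y] step[of y x] by blast
  qed
qed

lemma bridgeless_if_cuts:
  assumes "simple_graph V E"
    and cuts: "\<And>S. S \<subseteq> V \<Longrightarrow> S \<noteq> {} \<Longrightarrow> S \<noteq> V \<Longrightarrow> 2 \<le> card (edge_cut E S)"
  shows "bridgeless V E"
  unfolding bridgeless_def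
proof (intro allI impI, rule ccontr)
  fix u v assume uv: "{u, v} \<in> E" and n: "\<not> reach (E - {{u, v}}) u v"
  let ?S = "{w \<in> V. reach (E - {{u, v}}) u w}"
  have V: "u \<in> V" "v \<in> V" using uv assms(1) by (auto simp: simple_graph_def doubleton_eq_iff)
  have "u \<in> ?S" using V by (simp add: reach_def)
  moreover have "v \<notin> ?S" using n by simp
  ultimately have "2 \<le> card (edge_cut E ?S)" using cuts[of ?S] V by blast
  moreover have "card (edge_cut E ?S) \<le> card {{u, v}}"
    by (rule card_mono) (simp, rule cut_component_subset[OF assms(1)])
  ultimately show False by simp
qed

lemma is_cycle_card: "is_cycle V E xs \<Longrightarrow> 3 \<le> card (set xs)"
  by (simp add: is_cycle_def distinct_card)

text \<open>A cycle has at least three vertices, so two separated cycles leave at least three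
  vertices on both sides of the cut around the first component. Hence the threshold 2.\<close>

lemma cyclically_connected_if_cuts:
  assumes sg: "simple_graph V E" and fin: "finite E"
    and cuts: "\<And>S. S \<subseteq> V \<Longrightarrow> S \<noteq> {} \<Longrightarrow> S \<noteq> V \<Longrightarrow> card (edge_cut E S) < k \<Longrightarrow> card S \<le> 2 \<or> card (V - S) \<le> 2"
  shows "cyclically_connected k V E"
  unfolding cyclically_connected_def
proof (intro allI impI notI)
  fix F assume F: "F \<subseteq> E \<and> card F < k" and "cycle_separating V E F"
  then obtain u v xs ys where uv: "u \<in> V" "v \<in> V"
    and ne: "{w \<in> V. reach (E - F) u w} \<noteq> {w \<in> V. reach (E - F) v w}"
    and xs: "is_cycle V (E - F) xs" "set xs \<subseteq> {w \<in> V. reach (E - F) u w}"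
    and ys: "is_cycle V (E - F) ys" "set ys \<subseteq> {w \<in> V. reach (E - F) v w}"
    unfolding cycle_separating_def components_def component_has_cycle_def by blast
  let ?S = "{w \<in> V. reach (E - F) u w}" and ?T = "{w \<in> V. reach (E - F) v w}"
  have tr: "reach (E - F) a c" if "reach (E - F) a b" "reach (E - F) b c" for a b c
    using that unfolding reach_def by (rule rtranclp_trans)
  have disj: "?S \<inter> ?T = {}"
  proof (rule ccontr)
    assume "?S \<inter> ?T \<noteq> {}"
    then have "reach (E - F) u v" "reach (E - F) v u" using tr reach_sym by blast+
    then show False using ne tr by blast
  qed
  have finV: "finite V" using sg by (simp add: simple_graph_def)
  have "3 \<le> card (set xs)" "3 \<le> card (set ys)" using is_cycle_card xs ys by blast+
  moreover have "card (set xs) \<le> card ?S" using xs finV by (intro card_mono) auto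
  moreover have "card (set ys) \<le> card (V - ?S)" using ys disj finV by (intro card_mono) blast+
  ultimately have c: "3 \<le> card ?S" "3 \<le> card (V - ?S)" by linarith+
  have "card (edge_cut E ?S) \<le> card F"
    using F fin finite_subset by (intro card_mono cut_component_subset[OF sg]) blast
  then have "card (edge_cut E ?S) < k" using F by simp
  moreover have "?S \<noteq> {}" using uv by (auto simp: reach_def)
  moreover have "?S \<noteq> V"
  proof
    assume "?S = V"
    then have "V - ?S = {}" by blast
    then show False using c(2) by (simp only: card.empty)
  qed
  moreover have "?S \<subseteq> V" by blast
  ultimately have "card ?S \<le> 2 \<or> card (V - ?S) \<le> 2" by (intro cuts)
  then show False using c by linarith
qed

section \<open>The two blocks\<close>

text \<open>Vertices must be natural numbers, so vertex \<open>c\<close> of block \<open>i\<close>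
  is coded by a pairing function; what matters is its injectivity.\<close>

definition vx :: "nat \<Rightarrow> nat \<Rightarrow> nat" where
  "vx i c = prod_encode (i, c)"

lemma vx_eq_iff [simp]: "vx i c = vx j d \<longleftrightarrow> i = j \<and> c = d"
  by (simp add: vx_def prod_encode_eq)

text \<open>
  A flag \<^term>\<open>h\<close> selects the block: \<^term>\<open>True\<close> for H, \<^term>\<open>False\<close> for I. In both blocks the edges
  to the preceding block start at 0 and 1, those to the following block at 2 and 3. A slot is an edge seen
  from a block: besides the inner edges there are \<open>(2,10)\<close> and \<open>(3,11)\<close>, which lead to vertices 0 and 1
  of the following block, and \<open>(12,0)\<close> and \<open>(13,1)\<close>, which come from vertices 2 and 3 of the preceding one.
  The list \<open>rslots\<close> omits the last two, so that every edge of the ring belongs to one block.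
\<close>

fun inner :: "bool \<Rightarrow> (nat \<times> nat) list" where
  "inner False = [(0,4), (0,7), (1,5), (1,6), (2,4), (2,5), (3,6), (3,7), (4,6), (5,7)]"
| "inner True = [(0,5), (0,6), (1,4), (1,7), (2,4), (2,5), (3,6), (3,7), (4,8), (5,9), (6,8), (7,9), (8,9)]"

fun block_order :: "bool \<Rightarrow> nat" where
  "block_order False = 8"
| "block_order True = 10"

definition rslots :: "bool \<Rightarrow> (nat \<times> nat) list" where
  "rslots h = (2,10) # (3,11) # inner h"

definition slots :: "bool \<Rightarrow> (nat \<times> nat) list" where
  "slots h = (12,0) # (13,1) # rslots h"

text \<open>The labels 10 to 13 are not vertices of a block, so a slot leading out of the block is
  incident with just one vertex of it.\<close>

definition inc :: "nat \<Rightarrow> nat \<times> nat \<Rightarrow> bool" where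
  "inc c k \<longleftrightarrow> fst k = c \<or> snd k = c"

lemma inner_bound: "k \<in> set (inner h) \<Longrightarrow> fst k < snd k \<and> snd k < block_order h"
  by (cases h) auto

lemma block_order_bound: "4 < block_order h \<and> block_order h \<le> 10"
  by (cases h) auto

lemma distinct_rslots: "distinct (rslots h)"
  by (cases h) (auto simp: rslots_def)

lemma distinct_slots: "distinct (slots h)"
  by (cases h) (auto simp: rslots_def slots_def)

lemma less_block_order_iff:
  "c < block_order h \<longleftrightarrow> c = 0 \<or> c = 1 \<or> c = 2 \<or> c = 3 \<or> c = 4 \<or> c = 5 \<or> c = 6 \<or> c = 7 \<or>
    h \<and> (c = 8 \<or> c = 9)"
proof (cases h)
  case True
  then show ?thesis by simp presburger
next
  case False
  then show ?thesis by simp presburger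
qed

lemma local_degree:
  assumes "c < block_order h"
  shows "length (filter (inc c) (slots h)) = 3"
  using assms unfolding less_block_order_iff
  by (elim disjE conjE; cases h; simp add: slots_def rslots_def inc_def)

section \<open>Traces of perfect matchings on a block and the local inequalities\<close>

definition local_matching :: "bool \<Rightarrow> (nat \<times> nat \<Rightarrow> bool) \<Rightarrow> bool" where
  "local_matching h P \<longleftrightarrow> (\<forall>c<block_order h. length (filter (\<lambda>k. inc c k \<and> P k) (slots h)) = 1)"

text \<open>The characteristic vectors, along \<open>slots\<close>, of all possible traces of a perfect matching on a block.\<close>

definition matchings_I :: "bool list list" where
  "matchings_I = (let T = True; F = False in
    [[F,F,T,T,T,F,F,T,F,F,F,F,F,T],
     [F,F,F,F,T,F,F,T,F,T,F,T,F,F],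
     [F,T,T,F,T,F,F,F,F,F,T,F,F,T],
     [F,F,T,T,F,T,T,F,F,F,F,F,T,F],
     [F,F,F,F,F,T,T,F,T,F,T,F,F,F],
     [F,T,F,T,F,T,F,F,F,T,F,F,T,F],
     [T,F,T,F,F,F,T,F,F,F,F,T,T,F],
     [T,F,F,T,F,F,F,T,T,F,F,F,F,T],
     [T,T,T,T,F,F,F,F,F,F,F,F,T,T],
     [T,T,F,F,F,F,F,F,T,F,T,F,F,T],
     [T,T,F,F,F,F,F,F,F,T,F,T,T,F]])"

definition matchings_H :: "bool list list" where
  "matchings_H = (let T = True; F = False in
    [[F,F,T,T,T,F,T,F,F,F,F,F,F,F,T,T,F],
     [F,F,F,F,T,F,F,T,T,F,T,F,F,F,F,F,T],
     [F,T,T,F,T,F,F,F,F,F,T,F,T,F,F,T,F],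
     [F,T,F,T,T,F,F,F,T,F,F,F,F,F,T,T,F],
     [F,F,F,F,F,T,T,F,F,T,F,T,F,F,F,F,T],
     [F,F,T,T,F,T,F,T,F,F,F,F,T,T,F,F,F],
     [F,T,T,F,F,T,F,F,F,F,F,T,T,T,F,F,F],
     [F,T,F,T,F,T,F,F,F,T,F,F,T,F,F,T,F],
     [T,F,T,F,F,F,T,F,F,F,F,T,F,T,T,F,F],
     [T,F,F,T,F,F,T,F,F,T,F,F,F,F,T,T,F],
     [T,F,T,F,F,F,F,T,F,F,T,F,T,T,F,F,F],
     [T,F,F,T,F,F,F,T,T,F,F,F,F,T,T,F,F],
     [T,T,F,F,F,F,F,F,T,F,F,T,F,T,T,F,F],
     [T,T,F,F,F,F,F,F,F,T,T,F,T,F,F,T,F]])"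

fun uncovered :: "bool list \<Rightarrow> bool list \<Rightarrow> bool list \<Rightarrow> nat" where
  "uncovered (x # xs) (y # ys) (z # zs) = (if x \<or> y \<or> z then 0 else 1) + uncovered xs ys zs"
| "uncovered _ _ _ = 0"

lemma uncovered_map:
  "uncovered (map P ks) (map Q ks) (map R ks) = length (filter (\<lambda>k. \<not> P k \<and> \<not> Q k \<and> \<not> R k) ks)"
  by (induction ks) auto

text \<open>
  Twice the potential of two parallel edges between consecutive blocks, where \<open>x, y, z\<close> tell which of
  the three matchings contain the first edge and \<open>x', y', z'\<close> which contain the second. It is 3 when
  the edges have two distinct colours, the only state in which an H-block can have no uncovered edge.
\<close>

definition psi :: "bool \<Rightarrow> bool \<Rightarrow> bool \<Rightarrow> bool \<Rightarrow> bool \<Rightarrow> bool \<Rightarrow> nat" where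
  "psi x x' y y' z z' =
    (let w = of_bool (x \<noteq> x') + of_bool (y \<noteq> y') + of_bool (z \<noteq> z') :: nat
     in if w = 1 then 1
        else if w = 2 \<and> of_bool x + of_bool y + of_bool z = (1::nat)
          \<and> of_bool x' + of_bool y' + of_bool z' = (1::nat) then 3 else 0)"

text \<open>The four leading entries are the edges leaving the block. They are charged to an H-block
  but not to an I-block, so no edge is charged twice when H-blocks are never consecutive, and the
  \<open>psi\<close> of a pair of edges between an H-block and an I-block cancels in the sum. All
  quantities are doubled: 6 stands for three uncovered edges.\<close>

fun bound :: "bool \<Rightarrow> bool list \<Rightarrow> bool list \<Rightarrow> bool list \<Rightarrow> bool" where
  "bound h (a # a' # d # d' # as) (b # b' # e # e' # bs) (c # c' # f # f' # cs) =
    (if h then 6 \<le> psi a a' b b' c c' + psi d d' e e' f f' + 2 * uncovered (a # a' # d # d' # as) (b # b' # e # e' # bs) (c # c' # f # f' # cs)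
     else psi a a' b b' c c' + psi d d' e e' f f' \<le> 2 * uncovered as bs cs)"
| "bound _ _ _ _ = False"

definition exactly_one :: "bool \<Rightarrow> bool \<Rightarrow> bool \<Rightarrow> bool" where
  "exactly_one a b c \<longleftrightarrow> (if a then \<not> b \<and> \<not> c else b \<noteq> c)"

lemma exactly_one_simps:
  "exactly_one True b c \<longleftrightarrow> \<not> b \<and> \<not> c"
  "exactly_one a True c \<longleftrightarrow> \<not> a \<and> \<not> c"
  "exactly_one a b True \<longleftrightarrow> \<not> a \<and> \<not> b"
  "exactly_one False False c \<longleftrightarrow> c"
  "exactly_one False b False \<longleftrightarrow> b"
  "exactly_one a False False \<longleftrightarrow> a"
  by (auto simp: exactly_one_def)

text \<open>There is one hypothesis per vertex. Once the seven edges split on are fixed, each other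
  variable is forced by a vertex condition or a contradiction arises, so at most 2^7 cases have to
  be compared with the list.\<close>

lemma matchings_I_complete:
  assumes "exactly_one l0 x04 x07" "exactly_one l1 x15 x16" "exactly_one r0 x24 x25" "exactly_one r1 x36 x37"
    "exactly_one x04 x24 x46" "exactly_one x15 x25 x57" "exactly_one x16 x36 x46" "exactly_one x07 x37 x57"
  shows "[l0, l1, r0, r1, x04, x07, x15, x16, x24, x25, x36, x37, x46, x57] \<in> set matchings_I"
  using assms
  by (cases x46; cases x57; cases x04; cases x15; cases x25; cases x36; cases x37; simp add: exactly_one_simps)
    (simp_all add: matchings_I_def)

lemma matchings_H_complete:
  assumes "exactly_one l0 x05 x06" "exactly_one l1 x14 x17" "exactly_one r0 x24 x25" "exactly_one r1 x36 x37"
    "exactly_one x14 x24 x48" "exactly_one x05 x25 x59" "exactly_one x06 x36 x68" "exactly_one x17 x37 x79"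
    "exactly_one x48 x68 x89" "exactly_one x59 x79 x89"
  shows "[l0, l1, r0, r1, x05, x06, x14, x17, x24, x25, x36, x37, x48, x59, x68, x79, x89] \<in> set matchings_H"
  using assms
  by (cases x89; cases x48; cases x59; cases x14; cases x05; cases x36; cases x37; simp add: exactly_one_simps)
    (simp_all add: matchings_H_def)

lemma length_filter_three: "length (filter P [a, b, c]) = 1 \<longleftrightarrow> exactly_one (P a) (P b) (P c)"
  by (simp add: exactly_one_def)

lemma local_matching_vertex:
  assumes "local_matching h P" "c < block_order h" "filter (inc c) (slots h) = [k1, k2, k3]"
  shows "exactly_one (P k1) (P k2) (P k3)"
proof -
  have "filter (\<lambda>k. inc c k \<and> P k) (slots h) = filter P (filter (inc c) (slots h))"
    by (simp add: conj_commute)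
  then show ?thesis
    using assms unfolding local_matching_def length_filter_three[symmetric] by metis
qed

lemma local_matching_I:
  assumes "local_matching False P"
  shows "map P (slots False) \<in> set matchings_I"
proof -
  note v = local_matching_vertex[OF assms]
  show ?thesis
    unfolding slots_def rslots_def inner.simps list.map
    apply (rule matchings_I_complete)
    apply (rule v[of 0], simp, simp add: slots_def rslots_def inc_def)
    apply (rule v[of 1], simp, simp add: slots_def rslots_def inc_def)
    apply (rule v[of 2], simp, simp add: slots_def rslots_def inc_def)
    apply (rule v[of 3], simp, simp add: slots_def rslots_def inc_def)
    apply (rule v[of 4], simp, simp add: slots_def rslots_def inc_def)
    apply (rule v[of 5], simp, simp add: slots_def rslots_def inc_def)
    apply (rule v[of 6], simp, simp add: slots_def rslots_def inc_def)
    apply (rule v[of 7], simp, simp add: slots_def rslots_def inc_def)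
    done
qed

lemma local_matching_H:
  assumes "local_matching True P"
  shows "map P (slots True) \<in> set matchings_H"
proof -
  note v = local_matching_vertex[OF assms]
  show ?thesis
    unfolding slots_def rslots_def inner.simps list.map
    apply (rule matchings_H_complete)
    apply (rule v[of 0], simp, simp add: slots_def rslots_def inc_def)
    apply (rule v[of 1], simp, simp add: slots_def rslots_def inc_def)
    apply (rule v[of 2], simp, simp add: slots_def rslots_def inc_def)
    apply (rule v[of 3], simp, simp add: slots_def rslots_def inc_def)
    apply (rule v[of 4], simp, simp add: slots_def rslots_def inc_def)
    apply (rule v[of 5], simp, simp add: slots_def rslots_def inc_def)
    apply (rule v[of 6], simp, simp add: slots_def rslots_def inc_def)
    apply (rule v[of 7], simp, simp add: slots_def rslots_def inc_def)
    apply (rule v[of 8], simp, simp add: slots_def rslots_def inc_def)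
    apply (rule v[of 9], simp, simp add: slots_def rslots_def inc_def)
    done
qed

text \<open>All 11^3 ordered triples of traces are evaluated, repetitions included; for the H-block
  there are 14^3.\<close>

lemma bound_I: "list_all (\<lambda>a. list_all (\<lambda>b. list_all (bound False a b) matchings_I) matchings_I) matchings_I"
  by code_simp

lemma bound_H: "list_all (\<lambda>a. list_all (\<lambda>b. list_all (bound True a b) matchings_H) matchings_H) matchings_H"
  by code_simp

lemma local_bound_I:
  assumes "local_matching False P" "local_matching False Q" "local_matching False R"
  shows "psi (P (12,0)) (P (13,1)) (Q (12,0)) (Q (13,1)) (R (12,0)) (R (13,1))
      + psi (P (2,10)) (P (3,11)) (Q (2,10)) (Q (3,11)) (R (2,10)) (R (3,11))
    \<le> 2 * length (filter (\<lambda>k. \<not> P k \<and> \<not> Q k \<and> \<not> R k) (inner False))"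
proof -
  have "bound False (map P (slots False)) (map Q (slots False)) (map R (slots False))"
    using bound_I assms[THEN local_matching_I] by (simp only: list_all_iff)
  then show ?thesis
    unfolding slots_def rslots_def list.map bound.simps if_False uncovered_map .
qed

lemma local_bound_H:
  assumes "local_matching True P" "local_matching True Q" "local_matching True R"
  shows "6 \<le> psi (P (12,0)) (P (13,1)) (Q (12,0)) (Q (13,1)) (R (12,0)) (R (13,1))
      + psi (P (2,10)) (P (3,11)) (Q (2,10)) (Q (3,11)) (R (2,10)) (R (3,11))
      + 2 * length (filter (\<lambda>k. \<not> P k \<and> \<not> Q k \<and> \<not> R k) (slots True))"
proof -
  have "bound True (map P (slots True)) (map Q (slots True)) (map R (slots True))"
    using bound_H assms[THEN local_matching_H] by (simp only: list_all_iff)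
  then show ?thesis
    unfolding slots_def rslots_def list.map bound.simps if_True
    \<comment> \<open>The H-bound counts the leaving edges too, so the entries split off for
      \<open>bound\<close> are folded back into one \<open>map\<close> over all slots.\<close>
    unfolding list.map[symmetric] uncovered_map .
qed

section \<open>Edge cuts inside a block\<close>

definition inner_cut :: "bool \<Rightarrow> (nat \<Rightarrow> bool) \<Rightarrow> nat" where
  "inner_cut h X = length (filter (\<lambda>(a, b). X a \<noteq> X b) (inner h))"

text \<open>\<open>ds\<close> flags the cut inner edges, \<open>bs\<close> the chosen vertices among
  0 to 3, and \<open>xs\<close> all chosen vertices. If nothing outside the block is chosen, each
  vertex counted in \<open>b\<close> also has its leaving edge cut, so \<open>d + b\<close> is the
  size of the whole cut; if that is three, a single vertex is cut off.\<close>

definition cut_ok :: "bool list \<Rightarrow> bool list \<Rightarrow> bool list \<Rightarrow> bool" where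
  "cut_ok ds bs xs \<longleftrightarrow>
    (let d = length (filter id ds); b = length (filter id bs); w = length (filter id xs)
     in (2 \<le> d \<or> w = 0 \<or> w = length xs) \<and> (4 \<le> d + b \<or> w = 0 \<or> d + b = 3 \<and> w = 1))"

lemma cut_ok_I:
  "\<forall>x0 x1 x2 x3 x4 x5 x6 x7.
    cut_ok [x0 \<noteq> x4, x0 \<noteq> x7, x1 \<noteq> x5, x1 \<noteq> x6, x2 \<noteq> x4, x2 \<noteq> x5, x3 \<noteq> x6, x3 \<noteq> x7, x4 \<noteq> x6, x5 \<noteq> x7]
      [x0, x1, x2, x3] [x0, x1, x2, x3, x4, x5, x6, x7]"
  by code_simp

lemma cut_ok_H:
  "\<forall>x0 x1 x2 x3 x4 x5 x6 x7 x8 x9.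
    cut_ok [x0 \<noteq> x5, x0 \<noteq> x6, x1 \<noteq> x4, x1 \<noteq> x7, x2 \<noteq> x4, x2 \<noteq> x5, x3 \<noteq> x6, x3 \<noteq> x7,
        x4 \<noteq> x8, x5 \<noteq> x9, x6 \<noteq> x8, x7 \<noteq> x9, x8 \<noteq> x9]
      [x0, x1, x2, x3] [x0, x1, x2, x3, x4, x5, x6, x7, x8, x9]"
  by code_simp

lemma length_filter_id_map: "length (filter id (map f xs)) = length (filter f xs)"
  by (simp add: filter_map o_def)

lemma upt_block_order:
  "[0..<block_order False] = [0, 1, 2, 3, 4, 5, 6, 7]"
  "[0..<block_order True] = [0, 1, 2, 3, 4, 5, 6, 7, 8, 9]"
  by (simp_all add: upt_rec eval_nat_numeral)

lemma cut_ok: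
  "cut_ok (map (\<lambda>(a, b). X a \<noteq> X b) (inner h)) (map X [0, 1, 2, 3]) (map X [0..<block_order h])"
  using cut_ok_I cut_ok_H
  by (cases h) (simp_all only: inner.simps upt_block_order list.map prod.case)

lemma inner_cut_cases:
  fixes X :: "nat \<Rightarrow> bool" and h :: bool
  defines "d \<equiv> inner_cut h X" and "b \<equiv> length (filter X [0, 1, 2, 3])" and "w \<equiv> length (filter X [0..<block_order h])"
  shows "2 \<le> d \<or> w = 0 \<or> w = block_order h" "4 \<le> d + b \<or> w = 0 \<or> d + b = 3 \<and> w = 1"
  using cut_ok[of X h] unfolding cut_ok_def Let_def length_filter_id_map d_def b_def w_def inner_cut_def by simp_all

lemma inner_cut_nonconstant:
  assumes "a < block_order h" "b < block_order h" "X a" "\<not> X b"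
  shows "2 \<le> inner_cut h X"
proof -
  let ?w = "length (filter X [0..<block_order h])"
  have "filter X [0..<block_order h] \<noteq> []"
    using assms by (auto simp: filter_empty_conv)
  then have "?w \<noteq> 0" by simp
  moreover have "?w < length [0..<block_order h]"
    by (rule length_filter_less[of b]) (use assms in auto)
  ultimately show ?thesis using inner_cut_cases(1)[of h X] by simp
qed

lemma inner_cut_boundary:
  assumes "a < block_order h" "X a"
  shows "3 \<le> inner_cut h X + length (filter X [0, 1, 2, 3])"
    and "inner_cut h X + length (filter X [0, 1, 2, 3]) \<le> 3 \<Longrightarrow> card {c. c < block_order h \<and> X c} = 1"
proof -
  let ?w = "length (filter X [0..<block_order h])"
  have "filter X [0..<block_order h] \<noteq> []"
    using assms by (auto simp: filter_empty_conv)
  then have w: "?w \<noteq> 0" by simp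
  have c: "card {c. c < block_order h \<and> X c} = ?w"
    unfolding length_filter_conv_card by (intro arg_cong[where f = card]) auto
  show "3 \<le> inner_cut h X + length (filter X [0, 1, 2, 3])"
    using inner_cut_cases(2)[of h X] w by linarith
  show "card {c. c < block_order h \<and> X c} = 1"
    if "inner_cut h X + length (filter X [0, 1, 2, 3]) \<le> 3"
    using inner_cut_cases(2)[of h X] w that unfolding c by linarith
qed

section \<open>Short cycles inside a block\<close>

definition adjacent :: "bool \<Rightarrow> nat \<Rightarrow> nat \<Rightarrow> bool" where
  "adjacent h a b \<longleftrightarrow> (a, b) \<in> set (inner h) \<or> (b, a) \<in> set (inner h)"

definition symm :: "(nat \<times> nat) list \<Rightarrow> (nat \<times> nat) list" where
  "symm ks = ks @ map (\<lambda>(a, b). (b, a)) ks"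

lemma adjacent_symm: "adjacent h a b \<longleftrightarrow> (a, b) \<in> set (symm (inner h))"
  by (auto simp: adjacent_def symm_def)

text \<open>All paths a, b, c, d without backtracking are enumerated: \<open>d \<noteq> a\<close>
  excludes triangles, and the absence of an edge from \<open>d\<close> to \<open>a\<close> excludes
  four-cycles.\<close>

lemma girth_check:
  "\<forall>h. list_all (\<lambda>(a, b). list_all (\<lambda>(b', c). b' = b \<longrightarrow> c \<noteq> a \<longrightarrow>
      list_all (\<lambda>(c', d). c' = c \<longrightarrow> d \<noteq> b \<longrightarrow> d \<noteq> a \<and> (d, a) \<notin> set (symm (inner h))) (symm (inner h)))
      (symm (inner h))) (symm (inner h))"
  by code_simp

lemma adjacent_no_short_cycle:
  assumes "adjacent h a b" "adjacent h b c" "adjacent h c d" "c \<noteq> a" "d \<noteq> b"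
  shows "d \<noteq> a" "\<not> adjacent h d a"
proof -
  have "fst (b, c) = snd (a, b)" "snd (b, c) \<noteq> fst (a, b)" "fst (c, d) = snd (b, c)" "snd (c, d) \<noteq> snd (a, b)"
    using assms(4,5) by simp_all
  note * = girth_check[unfolded list_all_iff case_prod_beta, rule_format,
    OF assms(1,2)[unfolded adjacent_symm] this(1,2) assms(3)[unfolded adjacent_symm] this(3,4), unfolded fst_conv snd_conv]
  show "d \<noteq> a" "\<not> adjacent h d a"
    using * unfolding adjacent_symm by blast+
qed

lemma adjacent_irrefl: "\<not> adjacent h a a"
  by (cases h) (auto simp: adjacent_def)

text \<open>This keeps the two parallel edges between consecutive blocks from lying on a common
  four-cycle.\<close>

lemma adjacent_danglers: "\<not> adjacent h 0 1" "\<not> adjacent h 1 0" "\<not> adjacent h 2 3" "\<not> adjacent h 3 2"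
  by (cases h; simp add: adjacent_def)+

section \<open>Three explicit matchings on a block\<close>

lemma local_matching_cong:
  assumes "\<And>k. k \<in> set (slots h) \<Longrightarrow> P k = Q k"
  shows "local_matching h P = local_matching h Q"
proof -
  have "filter (\<lambda>k. inc c k \<and> P k) (slots h) = filter (\<lambda>k. inc c k \<and> Q k) (slots h)" for c
    using assms by (intro filter_cong refl) auto
  then show ?thesis unfolding local_matching_def by simp
qed

text \<open>
  Both edges leaving a block to the right are covered only by matching 0 after an I-block and only by
  matching 1 after an H-block; \<open>g\<close> is the flag of the preceding block.
\<close>

fun pattern :: "bool \<Rightarrow> bool \<Rightarrow> nat \<Rightarrow> (nat \<times> nat) list" where
  "pattern True g 0 = [(12,0), (13,1), (2,4), (3,7), (5,9), (6,8)]"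
| "pattern True g (Suc 0) = [(2,10), (3,11), (0,5), (1,4), (6,8), (7,9)]"
| "pattern True g (Suc (Suc m)) = [(0,5), (1,7), (2,4), (3,6), (8,9)]"
| "pattern False False 0 = [(12,0), (13,1), (2,10), (3,11), (4,6), (5,7)]"
| "pattern False False (Suc 0) = [(0,4), (1,6), (2,5), (3,7)]"
| "pattern False True 0 = [(2,10), (3,11), (0,4), (1,6), (5,7)]"
| "pattern False True (Suc 0) = [(12,0), (13,1), (2,5), (3,7), (4,6)]"
| "pattern False g (Suc (Suc m)) = [(0,7), (1,5), (2,4), (3,6)]"

lemma nat_three_cases:
  fixes m :: nat
  obtains "m = 0" | "m = Suc 0" | m' where "m = Suc (Suc m')"
  by (metis not0_implies_Suc)

lemma local_matching_pattern: "local_matching h (\<lambda>k. k \<in> set (pattern h g m))"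
  unfolding local_matching_def less_block_order_iff slots_def rslots_def
  by (rule nat_three_cases[of m]; cases h; cases g) (auto simp: inc_def)

lemma pattern_dangling:
  "(2,10) \<in> set (pattern h g m) \<longleftrightarrow> m = of_bool h" "(3,11) \<in> set (pattern h g m) \<longleftrightarrow> m = of_bool h"
  by (rule nat_three_cases[of m]; cases h; cases g; simp)+

text \<open>The patterns of an H-block ignore \<open>g\<close> and presuppose a preceding I-block,
  hence the hypothesis.\<close>

lemma pattern_left:
  assumes "\<not> (h \<and> g)"
  shows "(12,0) \<in> set (pattern h g m) \<longleftrightarrow> m = of_bool g" "(13,1) \<in> set (pattern h g m) \<longleftrightarrow> m = of_bool g"
  by (rule nat_three_cases[of m]; insert assms; cases h; cases g; simp)+

text \<open>The slots missed in an H-block are \<open>(0,6)\<close>, \<open>(2,5)\<close> and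
  \<open>(4,8)\<close>.\<close>

lemma uncovered_pattern:
  "length (filter (\<lambda>k. k \<notin> set (pattern h g 0) \<and> k \<notin> set (pattern h g 1) \<and> k \<notin> set (pattern h g 2)) (rslots h))
    = 3 * of_bool h"
  by (cases h; cases g) (simp_all add: rslots_def numeral_2_eq_2)

section \<open>Rings of blocks\<close>

text \<open>With at least three blocks, the block before and the block after a given one are
  distinct, so consecutive blocks are joined in one direction only.\<close>

locale block_ring =
  fixes n :: nat and t :: "nat \<Rightarrow> bool"
  assumes n_ge: "3 \<le> n"
begin

definition nx :: "nat \<Rightarrow> nat" where "nx i = (if Suc i = n then 0 else Suc i)"

definition pv :: "nat \<Rightarrow> nat" where "pv i = (if i = 0 then n - 1 else i - 1)"

definition edge :: "nat \<Rightarrow> nat \<times> nat \<Rightarrow> nat set" where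
  "edge i k = {vx i (fst k), if snd k < 10 then vx i (snd k) else vx (nx i) (snd k - 10)}"

text \<open>A slot entering from the left is renamed to the slot under which the preceding block
  owns that edge: \<open>(12,0)\<close> becomes \<open>(2,10)\<close> and \<open>(13,1)\<close>
  becomes \<open>(3,11)\<close>.\<close>

definition ledge :: "nat \<Rightarrow> nat \<times> nat \<Rightarrow> nat set" where
  "ledge i k = (if 12 \<le> fst k then edge (pv i) (fst k - 10, snd k + 10) else edge i k)"

definition V :: "nat set" where
  "V = {vx i c | i c. i < n \<and> c < block_order (t i)}"

definition E :: "nat set set" where
  "E = {edge i k | i k. i < n \<and> k \<in> set (rslots (t i))}"

lemma nx_less [simp]: "i < n \<Longrightarrow> nx i < n" and pv_less [simp]: "i < n \<Longrightarrow> pv i < n"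
  and nx_pv [simp]: "i < n \<Longrightarrow> nx (pv i) = i" and pv_nx [simp]: "i < n \<Longrightarrow> pv (nx i) = i"
  using n_ge by (auto simp: nx_def pv_def)

lemma nx_neq [simp]: "nx i \<noteq> i" "i \<noteq> nx i" "nx (nx i) \<noteq> i" "i \<noteq> nx (nx i)"
  using n_ge by (auto simp: nx_def split: if_splits)

lemma pv_neq [simp]: "i < n \<Longrightarrow> pv i \<noteq> i" "i < n \<Longrightarrow> i \<noteq> pv i"
  using n_ge by (auto simp: pv_def)

lemma nx_inj [simp]: "i < n \<Longrightarrow> j < n \<Longrightarrow> nx i = nx j \<longleftrightarrow> i = j"
  by (metis pv_nx)

lemma sum_pv: "(\<Sum>i<n. f (pv i)) = (\<Sum>i<n. f i)"
  by (rule sum.reindex_bij_witness[of _ nx pv]) auto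

section \<open>Edges, degrees and perfect matchings of the ring\<close>

lemma rslots_cases:
  assumes "k \<in> set (rslots h)"
  obtains "k = (2,10)" | "k = (3,11)" | a b where "k = (a, b)" "k \<in> set (inner h)" "a < b" "b < block_order h" "b < 10"
proof -
  have "k = (2,10) \<or> k = (3,11) \<or> k \<in> set (inner h)" using assms by (auto simp: rslots_def)
  then show thesis
    using inner_bound[of k h] block_order_bound[of h] that by (metis fst_conv snd_conv prod.exhaust_sel less_le_trans)
qed

lemma edge_simps:
  "edge i (2,10) = {vx i 2, vx (nx i) 0}" "edge i (3,11) = {vx i 3, vx (nx i) 1}"
  "b < 10 \<Longrightarrow> edge i (a, b) = {vx i a, vx i b}"
  by (simp_all add: edge_def)

text \<open>Inner slots list their ends in increasing order, and an edge between two blocks is owned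
  by the left one, so every edge has one name.\<close>

lemma edge_eq_iff:
  assumes "k \<in> set (rslots (t i))" "l \<in> set (rslots (t j))"
  shows "edge i k = edge j l \<longleftrightarrow> i = j \<and> k = l"
  by (rule rslots_cases[OF assms(1)]; rule rslots_cases[OF assms(2)])
    (auto simp: edge_simps doubleton_eq_iff)

lemma card_filter_E:
  "card {e \<in> E. Q e} = (\<Sum>i<n. length (filter (\<lambda>k. Q (edge i k)) (rslots (t i))))"
proof -
  let ?A = "SIGMA i:{..<n}. set (filter (\<lambda>k. Q (edge i k)) (rslots (t i)))"
  have "{e \<in> E. Q e} = (\<lambda>(i, k). edge i k) ` ?A"
    by (auto simp: E_def image_iff)
  moreover have "inj_on (\<lambda>(i, k). edge i k) ?A"
    by (auto simp: inj_on_def edge_eq_iff)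
  ultimately have "card {e \<in> E. Q e} = card ?A" by (simp add: card_image)
  also have "\<dots> = (\<Sum>i<n. card (set (filter (\<lambda>k. Q (edge i k)) (rslots (t i)))))"
    by simp
  also have "\<dots> = (\<Sum>i<n. length (filter (\<lambda>k. Q (edge i k)) (rslots (t i))))"
    by (intro sum.cong refl distinct_card distinct_filter distinct_rslots)
  finally show ?thesis .
qed

lemma finite_E [simp]: "finite E"
proof -
  have "E = (\<Union>i<n. edge i ` set (rslots (t i)))" by (auto simp: E_def)
  then show ?thesis by simp
qed

lemma V_eq: "V = (\<Union>i<n. vx i ` {..<block_order (t i)})"
  by (auto simp: V_def)

lemma finite_V [simp]: "finite V"
  by (simp add: V_eq)

lemma vx_in_V [simp]: "vx i c \<in> V \<longleftrightarrow> i < n \<and> c < block_order (t i)"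
  by (auto simp: V_def)

lemma small_less_block_order [simp]: "0 < block_order h" "Suc 0 < block_order h" "2 < block_order h" "3 < block_order h"
  by (cases h; simp)+

lemma simple: "simple_graph V E"
proof -
  have "\<exists>u v. u \<noteq> v \<and> u \<in> V \<and> v \<in> V \<and> edge i k = {u, v}" if "i < n" "k \<in> set (rslots (t i))" for i k
    using that(2)
  proof (cases rule: rslots_cases)
    case 1 then show ?thesis using that(1) by (intro exI[of _ "vx i 2"] exI[of _ "vx (nx i) 0"]) (simp add: edge_simps)
  next
    case 2 then show ?thesis using that(1) by (intro exI[of _ "vx i 3"] exI[of _ "vx (nx i) 1"]) (simp add: edge_simps)
  next
    case (3 a b) then show ?thesis using that(1) by (intro exI[of _ "vx i a"] exI[of _ "vx i b"]) (simp add: edge_simps)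
  qed
  then show ?thesis unfolding simple_graph_def by (auto simp: E_def)
qed

lemma ledge_simps:
  "ledge j (12,0) = edge (pv j) (2,10)" "ledge j (13,1) = edge (pv j) (3,11)" "ledge j (13,Suc 0) = edge (pv j) (3,11)"
  "k \<in> set (rslots h) \<Longrightarrow> ledge j k = edge j k"
  using inner_bound[of k h] block_order_bound[of h]
  by (auto simp: ledge_def rslots_def)

lemma set_slots: "set (slots h) = {(12,0), (13,1)} \<union> set (rslots h)"
  by (auto simp: slots_def)

lemma vx_in_edge:
  assumes "k \<in> set (rslots h)" "c < 10"
  shows "vx j c \<in> edge i k \<longleftrightarrow> i = j \<and> inc c k \<or> nx i = j \<and> (k = (2,10) \<and> c = 0 \<or> k = (3,11) \<and> c = 1)"
  using assms(1) by (cases rule: rslots_cases) (use assms(2) in \<open>auto simp: edge_simps inc_def\<close>)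

lemma rslots_dangling: "(2,10) \<in> set (rslots h)" "(3,11) \<in> set (rslots h)"
  by (simp_all add: rslots_def)

text \<open>This makes degrees and perfect matchings of the ring local conditions on the slots of
  single blocks.\<close>

lemma incident_edges:
  assumes "j < n" "c < 10"
  shows "{e \<in> E. vx j c \<in> e} = ledge j ` {k \<in> set (slots (t j)). inc c k}"
proof (intro set_eqI iffI)
  fix e assume "e \<in> {e \<in> E. vx j c \<in> e}"
  then obtain i k where ik: "e = edge i k" "i < n" "k \<in> set (rslots (t i))" "vx j c \<in> edge i k"
    by (auto simp: E_def)
  from ik(4)[unfolded vx_in_edge[OF ik(3) assms(2)]]
  show "e \<in> ledge j ` {k \<in> set (slots (t j)). inc c k}"
  proof
    assume "i = j \<and> inc c k"
    then have "e = ledge j k" "k \<in> {k \<in> set (slots (t j)). inc c k}"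
      using ik by (auto simp: set_slots ledge_simps)
    then show ?thesis by blast
  next
    assume "nx i = j \<and> (k = (2,10) \<and> c = 0 \<or> k = (3,11) \<and> c = 1)"
    then have "e = ledge j (12,0) \<and> inc c (12,0) \<or> e = ledge j (13,1) \<and> inc c (13,1)"
      using ik by (auto simp: ledge_simps inc_def)
    moreover have "(12,0) \<in> set (slots (t j))" "(13,1) \<in> set (slots (t j))" by (simp_all add: slots_def)
    ultimately show ?thesis by blast
  qed
next
  fix e assume "e \<in> ledge j ` {k \<in> set (slots (t j)). inc c k}"
  then obtain k where k: "e = ledge j k" "k \<in> set (slots (t j))" "inc c k" by blast
  consider "k = (12,0)" | "k = (13,1)" | "k \<in> set (rslots (t j))" using k by (auto simp: set_slots)
  then show "e \<in> {e \<in> E. vx j c \<in> e}"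
  proof cases
    case 1
    then have "e = edge (pv j) (2,10)" "c = 0" using k assms by (auto simp: ledge_simps inc_def)
    moreover have "edge (pv j) (2,10) \<in> E" unfolding E_def using assms rslots_dangling pv_less by blast
    ultimately show ?thesis using assms by (simp add: edge_simps)
  next
    case 2
    then have "e = edge (pv j) (3,11)" "c = 1" using k assms by (auto simp: ledge_simps inc_def)
    moreover have "edge (pv j) (3,11) \<in> E" unfolding E_def using assms rslots_dangling pv_less by blast
    ultimately show ?thesis using assms by (simp add: edge_simps)
  next
    case 3
    then have "e = edge j k" using k by (simp add: ledge_simps)
    moreover have "edge j k \<in> E" unfolding E_def using assms 3 by blast
    ultimately show ?thesis using k assms vx_in_edge[OF 3 assms(2)] by simp
  qed
qed

lemma inj_on_ledge:
  assumes "j < n"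
  shows "inj_on (ledge j) (set (slots (t j)))"
proof (rule inj_onI)
  fix k l assume "k \<in> set (slots (t j))" "l \<in> set (slots (t j))" "ledge j k = ledge j l"
  then show "k = l"
    using assms by (auto simp: set_slots ledge_simps edge_eq_iff rslots_dangling)
qed

lemma card_incident:
  assumes "j < n" "c < 10"
  shows "card {e \<in> E. vx j c \<in> e \<and> Q e} = length (filter (\<lambda>k. inc c k \<and> Q (ledge j k)) (slots (t j)))"
proof -
  have "{e \<in> E. vx j c \<in> e \<and> Q e} = {e \<in> {e \<in> E. vx j c \<in> e}. Q e}" by blast
  also have "\<dots> = ledge j ` set (filter (\<lambda>k. inc c k \<and> Q (ledge j k)) (slots (t j)))"
    unfolding incident_edges[OF assms] by auto
  finally have "card {e \<in> E. vx j c \<in> e \<and> Q e} = card (set (filter (\<lambda>k. inc c k \<and> Q (ledge j k)) (slots (t j))))"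
    using inj_on_subset[OF inj_on_ledge[OF assms(1)]] by (simp add: card_image)
  then show ?thesis using distinct_card[OF distinct_filter[OF distinct_slots]] by metis
qed

lemma cubic: "cubic_graph V E"
proof -
  have "degree E (vx j c) = 3" if "j < n" "c < block_order (t j)" for j c
  proof -
    have "c < 10" using that block_order_bound[of "t j"] by simp
    then show ?thesis using card_incident[OF that(1), of c "\<lambda>_. True"] local_degree[OF that(2)]
      by (simp add: degree_def)
  qed
  then show ?thesis using simple by (auto simp: cubic_graph_def V_def)
qed

lemma perfect_matching_iff:
  assumes "M \<subseteq> E"
  shows "perfect_matching V E M \<longleftrightarrow> (\<forall>j<n. local_matching (t j) (\<lambda>k. ledge j k \<in> M))"
proof -
  have "card {e \<in> M. vx j c \<in> e} = length (filter (\<lambda>k. inc c k \<and> ledge j k \<in> M) (slots (t j)))"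
    if "j < n" "c < block_order (t j)" for j c
  proof -
    have "{e \<in> M. vx j c \<in> e} = {e \<in> E. vx j c \<in> e \<and> e \<in> M}" using assms by blast
    then show ?thesis using card_incident[OF that(1), of c "\<lambda>e. e \<in> M"] that block_order_bound[of "t j"] by simp
  qed
  then show ?thesis using assms
    unfolding perfect_matching_def local_matching_def V_def by auto
qed

section \<open>Edge cuts of the ring\<close>

lemma edge_cut_compl: "edge_cut E (V - S) = edge_cut E S"
proof -
  have "e \<subseteq> V" if "e \<in> E" for e using that simple by (auto simp: simple_graph_def)
  then show ?thesis unfolding edge_cut_def by blast
qed

definition block_cut :: "nat set \<Rightarrow> nat \<Rightarrow> nat" where
  "block_cut S i = of_bool ((vx i 2 \<in> S) \<noteq> (vx (nx i) 0 \<in> S)) + of_bool ((vx i 3 \<in> S) \<noteq> (vx (nx i) 1 \<in> S))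
    + inner_cut (t i) (\<lambda>c. vx i c \<in> S)"

lemma card_edge_cut: "card (edge_cut E S) = (\<Sum>i<n. block_cut S i)"
proof -
  have "length (filter (\<lambda>k. \<not> edge i k \<subseteq> S \<and> edge i k \<inter> S \<noteq> {}) (rslots (t i))) = block_cut S i" for i
  proof -
    have "filter (\<lambda>k. \<not> edge i k \<subseteq> S \<and> edge i k \<inter> S \<noteq> {}) (inner (t i))
        = filter (\<lambda>(a, b). (vx i a \<in> S) \<noteq> (vx i b \<in> S)) (inner (t i))"
    proof (intro filter_cong refl)
      fix k assume "k \<in> set (inner (t i))"
      then have "snd k < 10" using inner_bound[of k "t i"] block_order_bound[of "t i"] by simp
      then show "(\<not> edge i k \<subseteq> S \<and> edge i k \<inter> S \<noteq> {}) = (case k of (a, b) \<Rightarrow> (vx i a \<in> S) \<noteq> (vx i b \<in> S))"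
        by (cases k) (auto simp: edge_simps)
    qed
    then show ?thesis
      by (simp add: rslots_def block_cut_def inner_cut_def edge_simps)
  qed
  then show ?thesis unfolding edge_cut_def card_filter_E by simp
qed

lemma block_cut_le:
  assumes "i < n" "j < n" "i \<noteq> j"
  shows "block_cut S i + block_cut S j \<le> card (edge_cut E S)"
proof -
  have "(\<Sum>k\<in>{i, j}. block_cut S k) \<le> (\<Sum>k<n. block_cut S k)"
    using assms by (intro sum_mono2) auto
  then show ?thesis using assms by (simp add: card_edge_cut)
qed

text \<open>Block \<open>m\<close> owns its inner edges and those leaving at 2 and 3, the preceding
  block those arriving at 0 and 1; together they account for the cut measured by
  \<open>inner_cut_boundary\<close>.\<close>

lemma single_block_cut:
  assumes "m < n" "T \<noteq> {}" "T \<subseteq> vx m ` {..<block_order (t m)}"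
  shows "3 \<le> card (edge_cut E T)" and "card (edge_cut E T) \<le> 3 \<Longrightarrow> card T = 1"
proof -
  let ?X = "\<lambda>c. vx m c \<in> T"
  have other: "vx i c \<in> T \<longleftrightarrow> i = m \<and> vx m c \<in> T" for i c using assms(3) by auto
  obtain a where a: "a < block_order (t m)" "?X a" using assms by auto
  have m: "nx m \<noteq> m" "pv m \<noteq> m" "nx (pv m) = m" using assms(1) by simp_all
  have "inner_cut (t m) ?X + length (filter ?X [0, 1, 2, 3]) \<le> block_cut T m + block_cut T (pv m)"
    using m unfolding block_cut_def other[of "nx m"] other[of "pv m"] by simp
  also have "\<dots> \<le> card (edge_cut E T)" using block_cut_le[of m "pv m" T] assms(1) m(2) by simp
  finally have le: "inner_cut (t m) ?X + length (filter ?X [0, 1, 2, 3]) \<le> card (edge_cut E T)" .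
  show "3 \<le> card (edge_cut E T)" using inner_cut_boundary(1)[of a "t m" ?X, OF a] le by linarith
  assume "card (edge_cut E T) \<le> 3"
  then have "card {c. c < block_order (t m) \<and> ?X c} = 1" using inner_cut_boundary(2)[of a "t m" ?X, OF a] le by linarith
  moreover have "T = vx m ` {c. c < block_order (t m) \<and> ?X c}" using assms(3) by auto
  moreover have "inj_on (vx m) A" for A by (simp add: inj_on_def)
  ultimately show "card T = 1" by (metis card_image)
qed

text \<open>A cut of at most three edges breaks at most one block. The other blocks all lie on the
  same side, so \<open>S\<close> or its complement is contained in a single block.\<close>

lemma ring_cut:
  assumes "S \<subseteq> V" "S \<noteq> {}" "S \<noteq> V"
  shows "3 \<le> card (edge_cut E S) \<and> (card (edge_cut E S) \<le> 3 \<longrightarrow> card S = 1 \<or> card (V - S) = 1)"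
proof (cases "card (edge_cut E S) \<le> 3")
  case le: True
  define X where "X i c \<longleftrightarrow> vx i c \<in> S" for i c
  define const where "const i \<longleftrightarrow> (\<forall>a<block_order (t i). X i a = X i 0)" for i
  have constD: "X i a = X i 0" if "const i" "a < block_order (t i)" for i a
    using that unfolding const_def by blast
  \<comment> \<open>A broken block owns at least two cut edges: inner ones if it is not constant,
    otherwise the two to the next block. A change towards a non-constant block is left to that
    block. Two broken blocks would thus cut four edges.\<close>
  define broken where "broken i \<longleftrightarrow> \<not> const i \<or> const (nx i) \<and> X i 0 \<noteq> X (nx i) 0" for i
  have cost: "2 \<le> block_cut S i" if "broken i" for i
  proof (cases "const i")
    case True
    then have "X i 2 = X i 0" "X i 3 = X i 0" using constD[of i 2] constD[of i 3] by simp_all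
    moreover have "const (nx i)" "X i 0 \<noteq> X (nx i) 0"
      using that True by (auto simp: broken_def)
    moreover from this have "X (nx i) 1 = X (nx i) 0" using constD[of "nx i" 1] by simp
    ultimately show ?thesis by (simp add: block_cut_def X_def)
  next
    case False
    then obtain a where a: "a < block_order (t i)" "X i a \<noteq> X i 0" unfolding const_def by blast
    then have "2 \<le> inner_cut (t i) (X i)"
      using inner_cut_nonconstant[of a "t i" 0 "X i"] inner_cut_nonconstant[of 0 "t i" a "X i"]
      by (cases "X i a") simp_all
    moreover have "X i = (\<lambda>c. vx i c \<in> S)" by (simp add: X_def fun_eq_iff)
    ultimately show ?thesis by (simp add: block_cut_def)
  qed
  have "i = j" if "i < n" "j < n" "broken i" "broken j" for i j
    using cost[OF that(3)] cost[OF that(4)] block_cut_le[OF that(1,2), of S] le by linarith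
  then obtain m where m: "m < n" "\<And>i. i < n \<Longrightarrow> i \<noteq> m \<Longrightarrow> \<not> broken i"
  proof (cases "\<exists>i<n. broken i")
    case False
    then show thesis using that[of 0] n_ge by auto
  qed blast
  have const: "const i" if "i < n" "i \<noteq> m" for i using m(2)[OF that] by (simp add: broken_def)
  have link: "X i 0 = X (nx i) 0" if "i < n" "i \<noteq> m" "const (nx i)" for i
    using m(2)[OF that(1,2)] that(3) by (auto simp: broken_def)
  \<comment> \<open>Without block \<open>m\<close> the ring is a path of constant blocks. It is
    followed from \<open>Suc m\<close> to \<open>n - 1\<close> and from 0 to \<open>m - 1\<close>,
    and the two stretches are linked at \<open>n - 1\<close> and 0.\<close>
  have above: "X i 0 = X (Suc m) 0" if "Suc m \<le> i" "i < n" for i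
    using that
  proof (induction i rule: dec_induct)
    case (step i)
    then show ?case using link[of i] const[of "Suc i"] by (simp add: nx_def)
  qed simp
  have below: "X i 0 = X 0 0" if "i < m" for i
    using that
  proof (induction i)
    case (Suc i)
    then show ?case using link[of i] const[of "Suc i"] m(1) by (simp add: nx_def)
  qed simp
  have same: "X i 0 = X (nx m) 0" if "i < n" "i \<noteq> m" for i
  proof (cases "Suc m = n")
    case True
    then show ?thesis using below[of i] that by (simp add: nx_def)
  next
    case False
    show ?thesis
    proof (cases "i < m")
      case True
      have "X (n - 1) 0 = X 0 0"
        using link[of "n - 1"] const[of 0] True False m(1) by (simp add: nx_def)
      then show ?thesis using above[of "n - 1"] below[OF True] False m(1) by (simp add: nx_def)
    next
      case False
      then show ?thesis using above[of i] that \<open>Suc m \<noteq> n\<close> by (simp add: nx_def)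
    qed
  qed
  have out: "vx i c \<in> S \<longleftrightarrow> X (nx m) 0" if "i < n" "i \<noteq> m" "c < block_order (t i)" for i c
    using same[OF that(1,2)] constD[OF const[OF that(1,2)] that(3)] unfolding X_def by blast
  \<comment> \<open>Otherwise block \<open>m\<close> would share the common value, making
    \<open>S\<close> empty or all of \<open>V\<close>.\<close>
  have "\<not> const m"
  proof
    assume "const m"
    then have "X (pv m) 0 = X m 0" using link[of "pv m"] m(1) by simp
    then have "X m 0 = X (nx m) 0" using same[of "pv m"] m(1) by simp
    then have "vx i c \<in> S \<longleftrightarrow> X (nx m) 0" if "i < n" "c < block_order (t i)" for i c
      using constD[OF \<open>const m\<close>, of c] out[of i c] that unfolding X_def by (cases "i = m") blast+
    then show False using assms unfolding V_def by blast
  qed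
  show ?thesis
  proof (cases "X (nx m) 0")
    case False
    have "S \<subseteq> vx m ` {..<block_order (t m)}"
      using assms(1) out False unfolding V_eq by blast
    then show ?thesis using single_block_cut[OF m(1), of S] assms by blast
  next
    case True
    have "V - S \<subseteq> vx m ` {..<block_order (t m)}"
      using out True unfolding V_eq by blast
    moreover have "V - S \<noteq> {}" using assms by blast
    ultimately show ?thesis using single_block_cut[OF m(1), of "V - S"] unfolding edge_cut_compl by blast
  qed
qed simp

lemma bridgeless: "bridgeless V E"
proof (intro bridgeless_if_cuts simple)
  fix S assume "S \<subseteq> V" "S \<noteq> {}" "S \<noteq> V"
  then show "2 \<le> card (edge_cut E S)" using ring_cut[of S] by linarith
qed

lemma cyclically_4_connected: "cyclically_connected 4 V E"
proof (intro cyclically_connected_if_cuts simple finite_E)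
  fix S assume "S \<subseteq> V" "S \<noteq> {}" "S \<noteq> V" "card (edge_cut E S) < 4"
  then show "card S \<le> 2 \<or> card (V - S) \<le> 2" using ring_cut[of S] by linarith
qed

section \<open>Girth of the ring\<close>

lemma edge_in_E_iff:
  "{vx i a, vx j b} \<in> E \<longleftrightarrow> i < n \<and> j < n \<and>
    (i = j \<and> adjacent (t i) a b \<or> j = nx i \<and> (a = 2 \<and> b = 0 \<or> a = 3 \<and> b = 1)
      \<or> i = nx j \<and> (b = 2 \<and> a = 0 \<or> b = 3 \<and> a = 1))" (is "?L \<longleftrightarrow> ?R")
proof
  assume ?L
  then obtain k l where kl: "{vx i a, vx j b} = edge l k" "l < n" "k \<in> set (rslots (t l))" by (auto simp: E_def)
  from kl(3) show ?R
    by (cases rule: rslots_cases) (use kl(1,2) in \<open>auto simp: edge_simps doubleton_eq_iff adjacent_def\<close>)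
next
  have inner: "{vx i a, vx i b} \<in> E" if "i < n" "(a, b) \<in> set (inner (t i))" for i a b
  proof -
    have "{vx i a, vx i b} = edge i (a, b)" "(a, b) \<in> set (rslots (t i))"
      using that inner_bound[of "(a, b)" "t i"] block_order_bound[of "t i"] by (auto simp: edge_simps rslots_def)
    then show ?thesis using that by (auto simp: E_def)
  qed
  have cross: "{vx i 2, vx (nx i) 0} \<in> E" "{vx i 3, vx (nx i) 1} \<in> E" if "i < n" for i
    using that rslots_dangling unfolding E_def edge_simps[symmetric] by blast+
  assume ?R
  then show ?L
    using inner[of i a b] inner[of i b a] cross[of i] cross[of j] by (auto simp: adjacent_def insert_commute)
qed

lemma edge_subset_V: "e \<in> E \<Longrightarrow> e \<subseteq> V"
  using simple by (auto simp: simple_graph_def)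

text \<open>Each of the vertices 0 to 3 has a single edge leaving its block, so \<open>p\<close>
  stays in block \<open>i\<close> and \<open>q\<close> in the next. If \<open>p\<close> and
  \<open>q\<close> were adjacent, \<open>p\<close> would be 2 or 3 and hence equal to, or a
  non-neighbour of, vertex \<open>a\<close>.\<close>

lemma crossing_edge_aux:
  assumes i: "i < n" and ab: "a = 2 \<and> b = 0 \<or> a = 3 \<and> b = 1"
    and p: "{p, vx i a} \<in> E" "p \<noteq> vx (nx i) b" and q: "{vx (nx i) b, q} \<in> E" "q \<noteq> vx i a"
  shows "p \<noteq> q \<and> {p, q} \<notin> E"
proof -
  have "p \<in> V" "q \<in> V" using edge_subset_V[OF p(1)] edge_subset_V[OF q(1)] by simp_all
  then obtain k c l d where kl: "p = vx k c" "q = vx l d" by (auto simp: V_def)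
  have "k = i" "adjacent (t i) c a"
    using p ab unfolding kl edge_in_E_iff by auto
  moreover have "l = nx i" "adjacent (t (nx i)) b d"
    using q ab i unfolding kl edge_in_E_iff by auto
  ultimately show ?thesis
    using ab adjacent_irrefl adjacent_danglers unfolding kl edge_in_E_iff by auto
qed

lemma crossing_edge:
  assumes xy: "{vx i a, vx j b} \<in> E" "i \<noteq> j"
    and p: "{p, vx i a} \<in> E" "p \<noteq> vx j b" and q: "{vx j b, q} \<in> E" "q \<noteq> vx i a"
  shows "p \<noteq> q" "{p, q} \<notin> E"
proof -
  have ij: "i < n" "j < n" using xy(1) by (simp_all add: edge_in_E_iff)
  from xy consider "j = nx i" "a = 2 \<and> b = 0 \<or> a = 3 \<and> b = 1" | "i = nx j" "b = 2 \<and> a = 0 \<or> b = 3 \<and> a = 1"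
    unfolding edge_in_E_iff by blast
  then have "p \<noteq> q \<and> {p, q} \<notin> E"
  proof cases
    case 1
    then show ?thesis using crossing_edge_aux[OF ij(1) 1(2), of p q] p q by blast
  next
    case 2
    then have "q \<noteq> p \<and> {q, p} \<notin> E"
      using crossing_edge_aux[OF ij(2) 2(2), of q p] p q by (simp add: insert_commute)
    then show ?thesis by (auto simp: insert_commute)
  qed
  then show "p \<noteq> q" "{p, q} \<notin> E" by simp_all
qed

text \<open>The case \<open>z = w\<close> is a triangle, the other a four-cycle. By
  \<open>crossing_edge\<close> neither contains an edge between blocks, so both lie inside one
  block, where \<open>girth_check\<close> applies.\<close>

lemma no_short_cycle:
  assumes E: "{w, x} \<in> E" "{x, y} \<in> E" "{y, z} \<in> E" and ne: "y \<noteq> w" "z \<noteq> x"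
  shows "z \<noteq> w \<and> {z, w} \<notin> E"
proof (rule ccontr)
  assume "\<not> (z \<noteq> w \<and> {z, w} \<notin> E)"
  then have closed: "z = w \<or> {z, w} \<in> E" by blast
  have "w \<in> V" "x \<in> V" "y \<in> V" "z \<in> V" using E[THEN edge_subset_V] by simp_all
  then obtain i a j b k c l d where c: "w = vx i a" "x = vx j b" "y = vx k c" "z = vx l d"
    by (auto simp: V_def)
  note E = E[unfolded c] and ne = ne[unfolded c] and closed = closed[unfolded c]
  have E': "{vx j b, vx i a} \<in> E" "{vx k c, vx j b} \<in> E" "{vx l d, vx k c} \<in> E"
    "{vx l d, vx i a} \<in> E \<Longrightarrow> {vx i a, vx l d} \<in> E"
    using E by (simp_all add: insert_commute)
  have jk: "j = k"
    using crossing_edge[OF E(2) _ E(1) _ E(3)] ne closed E'(4) by metis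
  have "c \<noteq> b" using E(2) adjacent_irrefl by (auto simp: jk edge_in_E_iff)
  have "j = i"
  proof (rule ccontr)
    assume "j \<noteq> i"
    from closed show False
    proof
      assume "vx l d = vx i a"
      then show False using crossing_edge(1)[OF E(1) _ _ _ E(2), of "vx k c"] E(3) ne \<open>j \<noteq> i\<close> \<open>c \<noteq> b\<close> by simp
    next
      assume "{vx l d, vx i a} \<in> E"
      then show False using crossing_edge(2)[OF E(1) _ _ _ E(2), of "vx l d"] E'(3) ne \<open>j \<noteq> i\<close> by simp
    qed
  qed
  moreover have "k = l"
  proof (rule ccontr)
    assume "k \<noteq> l"
    from closed show False
    proof
      assume "vx l d = vx i a"
      then show False using \<open>k \<noteq> l\<close> \<open>j = i\<close> jk by simp
    next
      assume "{vx l d, vx i a} \<in> E"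
      then show False using crossing_edge(2)[OF E(3) _ E(2), of "vx i a"] E'(1) ne \<open>k \<noteq> l\<close> by auto
    qed
  qed
  ultimately have "j = i" "k = i" "l = i" using jk by simp_all
  then have "adjacent (t i) a b" "adjacent (t i) b c" "adjacent (t i) c d" "c \<noteq> a" "d \<noteq> b"
    "d = a \<or> adjacent (t i) d a"
    using E ne closed by (simp_all add: edge_in_E_iff)
  then show False using adjacent_no_short_cycle[of "t i" a b c d] by blast
qed

lemma girth:
  assumes "\<not> t 0"
  shows "girth V E = 5"
proof -
  have "5 \<le> length xs" if "is_cycle V E xs" for xs
  proof (rule ccontr)
    assume "\<not> 5 \<le> length xs"
    with that consider "length xs = 3" | "length xs = 4" unfolding is_cycle_def by linarith
    then show False
    proof cases
      case 1
      then obtain x y z where xs: "xs = [x, y, z]" by (auto simp: length_Suc_conv numeral_eq_Suc)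
      have "{xs ! i, xs ! ((i + 1) mod 3)} \<in> E" if "i < 3" for i
        using \<open>is_cycle V E xs\<close> that 1 by (simp add: is_cycle_def)
      from this[of 0] this[of 1] this[of 2] have "{x, y} \<in> E" "{y, z} \<in> E" "{z, x} \<in> E" by (simp_all add: xs)
      moreover have "z \<noteq> x" "x \<noteq> y" using \<open>is_cycle V E xs\<close> by (auto simp: is_cycle_def xs)
      ultimately show False using no_short_cycle[of x y z x] by blast
    next
      case 2
      then obtain w x y z where xs: "xs = [w, x, y, z]" by (auto simp: length_Suc_conv numeral_eq_Suc)
      have "{xs ! i, xs ! ((i + 1) mod 4)} \<in> E" if "i < 4" for i
        using \<open>is_cycle V E xs\<close> that 2 by (simp add: is_cycle_def)
      from this[of 0] this[of 1] this[of 2] this[of 3]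
      have "{w, x} \<in> E" "{x, y} \<in> E" "{y, z} \<in> E" "{z, w} \<in> E" by (simp_all add: xs)
      moreover have "y \<noteq> w" "z \<noteq> x" using \<open>is_cycle V E xs\<close> by (auto simp: is_cycle_def xs)
      ultimately show False using no_short_cycle[of w x y z] by blast
    qed
  qed
  then have "5 \<le> girth V E" unfolding girth_def
    by (intro INF_greatest) (simp add: numeral_eq_enat)
  moreover have "girth V E \<le> 5"
  proof -
    \<comment> \<open>A five-cycle of the I-block; \<open>\<not> t 0\<close> makes block 0 such a
      block.\<close>
    let ?xs = "[vx 0 0, vx 0 4, vx 0 6, vx 0 3, vx 0 7]"
    have "{?xs ! i, ?xs ! ((i + 1) mod 5)} \<in> E" if "i < 5" for i
    proof -
      have "i \<in> {0, 1, 2, 3, 4}" using that by auto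
      then show ?thesis using n_ge assms by (auto simp: edge_in_E_iff adjacent_def)
    qed
    then have "is_cycle V E ?xs" using n_ge assms by (simp add: is_cycle_def)
    then have "girth V E \<le> enat (length ?xs)" unfolding girth_def by (intro INF_lower) simp
    moreover have "length ?xs = 5" by simp
    ultimately show ?thesis by (simp only: numeral_eq_enat)
  qed
  ultimately show ?thesis by (rule antisym[rotated])
qed

section \<open>Lower bound for the number of uncovered edges\<close>

lemma uncovered_lower:
  assumes sep: "\<And>i. i < n \<Longrightarrow> t i \<Longrightarrow> \<not> t (nx i)"
    and pm: "perfect_matching V E L" "perfect_matching V E M" "perfect_matching V E N"
  shows "3 * card {i. i < n \<and> t i} \<le> card {e \<in> E. e \<notin> L \<union> M \<union> N}"
proof -
  define un where "un e \<longleftrightarrow> e \<notin> L \<and> e \<notin> M \<and> e \<notin> N" for e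
  define U where "U i = length (filter (\<lambda>k. un (edge i k)) (inner (t i)))" for i
  define r where "r i = length (filter (\<lambda>k. un (edge i k)) [(2,10), (3,11)])" for i
  define s where "s i = psi (edge i (2,10) \<in> L) (edge i (3,11) \<in> L) (edge i (2,10) \<in> M) (edge i (3,11) \<in> M)
      (edge i (2,10) \<in> N) (edge i (3,11) \<in> N)" for i
  have loc: "local_matching (t i) (\<lambda>k. ledge i k \<in> L)" "local_matching (t i) (\<lambda>k. ledge i k \<in> M)"
      "local_matching (t i) (\<lambda>k. ledge i k \<in> N)" if "i < n" for i
    using pm that perfect_matching_iff by (auto simp: perfect_matching_def)
  have inn: "filter (\<lambda>k. ledge i k \<notin> L \<and> ledge i k \<notin> M \<and> ledge i k \<notin> N) (inner (t i))
      = filter (\<lambda>k. un (edge i k)) (inner (t i))" for i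
    by (intro filter_cong refl) (simp add: un_def ledge_simps(4)[of _ "t i"] rslots_def)
  have rs: "ledge i (2,10) = edge i (2,10)" "ledge i (3,11) = edge i (3,11)" for i
    by (simp_all add: ledge_simps(4)[of _ True] rslots_dangling)
  have H: "6 \<le> s (pv i) + s i + 2 * (r (pv i) + r i + U i)" if "i < n" "t i" for i
  proof -
    have "length (filter (\<lambda>k. ledge i k \<notin> L \<and> ledge i k \<notin> M \<and> ledge i k \<notin> N) (slots (t i)))
        = r (pv i) + r i + U i"
      unfolding slots_def rslots_def r_def U_def inn[symmetric]
      by (simp add: ledge_simps(1-3) rs un_def)
    then show ?thesis
      using local_bound_H[OF loc[OF that(1), unfolded eqTrueI[OF that(2)]]] that(2)
      by (simp add: ledge_simps(1-3) rs s_def)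
  qed
  have I: "s (pv i) + s i \<le> 2 * U i" if "i < n" "\<not> t i" for i
    using local_bound_I[OF loc[OF that(1), unfolded iffD2[OF eq_False that(2)]]] inn[of i] that(2)
    by (simp add: ledge_simps(1-3) rs s_def U_def)
  \<comment> \<open>What the edges from block \<open>i\<close> to the next contribute to the local
    inequality of one of these two blocks, \<open>b\<close> being the flag of that block. The minus
    sign calls for integers.\<close>
  define A where "A b i = (if b then int (2 * r i + s i) else - int (s i))" for b i
  \<comment> \<open>\<open>t (nx (pv i))\<close> is \<open>t i\<close>, written in the form that
    \<open>sum_pv\<close> reindexes.\<close>
  have "6 * int (of_bool (t i)) \<le> 2 * int (U i) + A (t i) i + A (t (nx (pv i))) (pv i)" if "i < n" for i
    using H[OF that] I[OF that] that by (cases "t i") (simp_all add: A_def)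
  then have "(\<Sum>i<n. 6 * int (of_bool (t i)))
      \<le> (\<Sum>i<n. 2 * int (U i) + A (t i) i + A (t (nx (pv i))) (pv i))"
    by (intro sum_mono) simp
  also have "\<dots> = (\<Sum>i<n. 2 * int (U i) + A (t i) i) + (\<Sum>i<n. A (t (nx i)) i)"
    using sum_pv[of "\<lambda>i. A (t (nx i)) i"] by (simp only: sum.distrib)
  also have "\<dots> = (\<Sum>i<n. 2 * int (U i) + (A (t i) i + A (t (nx i)) i))"
    by (simp add: sum.distrib)
  \<comment> \<open>Between an H-block and an I-block the potentials cancel and
    \<open>2 * r i\<close> remains; between two I-blocks the contribution is
    \<open>- 2 * s i\<close>, hence at most 0. By \<open>sep\<close> no other case occurs.\<close>
  also have "\<dots> \<le> (\<Sum>i<n. 2 * int (U i) + 2 * int (r i))"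
    using sep by (intro sum_mono add_left_mono) (auto simp: A_def)
  also have "\<dots> = 2 * int (\<Sum>i<n. r i + U i)"
    by (simp add: sum.distrib sum_distrib_left)
  also have "(\<Sum>i<n. r i + U i) = card {e \<in> E. un e}"
    unfolding card_filter_E rslots_def r_def U_def by (intro sum.cong refl) simp
  also have "{e \<in> E. un e} = {e \<in> E. e \<notin> L \<union> M \<union> N}" by (auto simp: un_def)
  also have "(\<Sum>i<n. 6 * int (of_bool (t i))) = 6 * int (card {i. i < n \<and> t i})"
  proof -
    have "(\<Sum>i<n. of_bool (t i)) = card {i. i < n \<and> t i}"
      by (simp add: of_bool_def sum.If_cases Int_def)
    then show ?thesis by (simp flip: sum_distrib_left of_nat_sum)
  qed
  finally show ?thesis by linarith
qed

section \<open>Matchings attaining the bound, and the value of \<open>m3\<close>\<close>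

definition PM :: "nat \<Rightarrow> nat set set" where
  "PM m = {edge i k | i k. i < n \<and> k \<in> set (rslots (t i)) \<and> k \<in> set (pattern (t i) (t (pv i)) m)}"

lemma edge_in_PM:
  assumes "i < n" "k \<in> set (rslots (t i))"
  shows "edge i k \<in> PM m \<longleftrightarrow> k \<in> set (pattern (t i) (t (pv i)) m)"
  using assms edge_eq_iff unfolding PM_def by blast

lemma perfect_matching_PM:
  assumes sep: "\<And>i. i < n \<Longrightarrow> t i \<Longrightarrow> \<not> t (nx i)"
  shows "perfect_matching V E (PM m)"
proof -
  have "PM m \<subseteq> E" unfolding PM_def E_def by blast
  moreover have "local_matching (t j) (\<lambda>k. ledge j k \<in> PM m)" if "j < n" for j
  proof -
    have "\<not> (t j \<and> t (pv j))" using sep[of "pv j"] that by auto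
    note left = pattern_left[OF this]
    have "ledge j k \<in> PM m \<longleftrightarrow> k \<in> set (pattern (t j) (t (pv j)) m)" if "k \<in> set (slots (t j))" for k
      using that \<open>j < n\<close> left edge_in_PM[OF \<open>j < n\<close>]
      by (auto simp: set_slots ledge_simps edge_in_PM rslots_dangling pattern_dangling)
    then show ?thesis
      using local_matching_cong[of "t j" "\<lambda>k. ledge j k \<in> PM m" "\<lambda>k. k \<in> set (pattern (t j) (t (pv j)) m)"]
        local_matching_pattern by simp
  qed
  ultimately show ?thesis by (simp add: perfect_matching_iff)
qed

lemma uncovered_PM: "card {e \<in> E. e \<notin> PM 0 \<union> PM 1 \<union> PM 2} = 3 * card {i. i < n \<and> t i}"
proof -
  have "length (filter (\<lambda>k. edge i k \<notin> PM 0 \<union> PM 1 \<union> PM 2) (rslots (t i))) = 3 * of_bool (t i)" if "i < n" for i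
    unfolding uncovered_pattern[of "t i" "t (pv i)", symmetric]
    using that by (intro arg_cong[where f = length] filter_cong refl) (simp add: edge_in_PM)
  then have "card {e \<in> E. e \<notin> PM 0 \<union> PM 1 \<union> PM 2} = (\<Sum>i<n. 3 * of_bool (t i))"
    unfolding card_filter_E by (intro sum.cong refl) simp
  also have "\<dots> = 3 * card {i. i < n \<and> t i}"
    by (simp add: sum_distrib_left[symmetric] of_bool_def sum.If_cases Int_def)
  finally show ?thesis .
qed

lemma card_E: "card E = 12 * n + 3 * card {i. i < n \<and> t i}"
proof -
  have "length (rslots h) = 12 + 3 * of_bool h" for h by (cases h) (simp_all add: rslots_def)
  then have "card E = (\<Sum>i<n. 12 + 3 * of_bool (t i))" using card_filter_E[of "\<lambda>_. True"] by simp
  also have "\<dots> = 12 * n + 3 * card {i. i < n \<and> t i}"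
    by (simp add: sum.distrib sum_distrib_left[symmetric] of_bool_def sum.If_cases Int_def)
  finally show ?thesis .
qed

lemma card_V: "card V = 8 * n + 2 * card {i. i < n \<and> t i}"
proof -
  have "V = (\<lambda>(i, c). vx i c) ` (SIGMA i:{..<n}. {..<block_order (t i)})"
    by (auto simp: V_def image_iff)
  moreover have "inj_on (\<lambda>(i, c). vx i c) A" for A by (auto simp: inj_on_def)
  ultimately have "card V = (\<Sum>i<n. block_order (t i))" by (simp add: card_image)
  also have "\<dots> = (\<Sum>i<n. 8 + 2 * of_bool (t i))"
  proof (intro sum.cong refl)
    show "block_order (t i) = 8 + 2 * of_bool (t i)" for i by (cases "t i") simp_all
  qed
  also have "\<dots> = 8 * n + 2 * card {i. i < n \<and> t i}"
    by (simp add: sum.distrib sum_distrib_left[symmetric] of_bool_def sum.If_cases Int_def)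
  finally show ?thesis .
qed

lemma m3:
  assumes sep: "\<And>i. i < n \<Longrightarrow> t i \<Longrightarrow> \<not> t (nx i)"
  shows "m3 V E = 1 - 3 * real (card {i. i < n \<and> t i}) / real (card E)"
proof -
  let ?h = "card {i. i < n \<and> t i}"
  let ?A = "{card (L \<union> M \<union> N) | L M N. perfect_matching V E L \<and> perfect_matching V E M \<and> perfect_matching V E N}"
  have covered: "card U + card {e \<in> E. e \<notin> U} = card E" if "U \<subseteq> E" for U
  proof -
    have "card (U \<union> {e \<in> E. e \<notin> U}) = card U + card {e \<in> E. e \<notin> U}"
      using that finite_E by (intro card_Un_disjoint) (auto intro: finite_subset)
    moreover have "U \<union> {e \<in> E. e \<notin> U} = E" using that by blast
    ultimately show ?thesis by simp
  qed
  have sub: "L \<subseteq> E" if "perfect_matching V E L" for L using that by (simp add: perfect_matching_def)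
  have up: "x \<le> card E - 3 * ?h" if "x \<in> ?A" for x
  proof -
    from that obtain L M N where x: "x = card (L \<union> M \<union> N)"
      and pm: "perfect_matching V E L" "perfect_matching V E M" "perfect_matching V E N" by blast
    have "L \<union> M \<union> N \<subseteq> E" using pm sub by blast
    then show ?thesis using covered[of "L \<union> M \<union> N"] uncovered_lower[OF sep pm] x by simp
  qed
  have "PM 0 \<union> PM 1 \<union> PM 2 \<subseteq> E" using perfect_matching_PM[OF sep] sub by blast
  then have "card (PM 0 \<union> PM 1 \<union> PM 2) = card E - 3 * ?h"
    using covered[of "PM 0 \<union> PM 1 \<union> PM 2"] uncovered_PM by simp
  then have "card E - 3 * ?h \<in> ?A" using perfect_matching_PM[OF sep] by (metis (mono_tags, lifting) mem_Collect_eq)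
  moreover have "finite ?A" using up by (meson finite_nat_set_iff_bounded_le)
  ultimately have "Max ?A = card E - 3 * ?h" using up by (intro Max_eqI) auto
  moreover have "3 * ?h \<le> card E" "real (card E) \<noteq> 0" using card_E n_ge by simp_all
  ultimately show ?thesis unfolding m3_def by (simp only: of_nat_diff diff_divide_distrib) simp
qed

end

section \<open>Choice of the parameters\<close>

lemma graph_iso_card:
  assumes "graph_iso (V, E) (V', E')"
  shows "card V = card V'"
  using assms by (auto simp: graph_iso_def intro: bij_betw_same_card)

lemma card_odd_less: "card {i. i < 2 * a \<and> odd i} = a"
proof -
  have "{i. i < 2 * a \<and> odd i} = (\<lambda>i. 2 * i + 1) ` {..<a}"
    by (auto simp: image_iff elim!: oddE)
  moreover have "inj_on (\<lambda>i::nat. 2 * i + 1) {..<a}" by (auto simp: inj_on_def)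
  ultimately show ?thesis by (simp add: card_image)
qed

theorem theorem2:
  fixes p q :: nat
  assumes "q > 0" and "9 / 10 \<le> real p / real q" and "real p / real q < 1"
  shows "\<exists>S :: (nat set \<times> nat set set) set. infinite S \<and>
    (\<forall>(V, E) \<in> S. cubic_graph V E \<and> bridgeless V E \<and> cyclically_connected 4 V E \<and>
        girth V E = 5 \<and> m3 V E = real p / real q) \<and>
    (\<forall>G \<in> S. \<forall>H \<in> S. G \<noteq> H \<longrightarrow> \<not> graph_iso G H)"
proof -
  define r where "r = q - p"
  have "p < q" using assms(1,3) by (simp add: field_simps)
  then have q: "q = p + r" "0 < r" by (simp_all add: r_def)
  have "9 * real q \<le> 10 * real p" using assms(1,2) by (simp add: field_simps)
  then have "9 * q \<le> 10 * p" by linarith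
  then have p: "9 * r \<le> p" using q by simp
  define n where "n k = p * Suc k" for k
  \<comment> \<open>H-blocks occupy odd places only. The place after an odd one is even, also where
    the ring closes at 0, so they are never consecutive, and block 0 is an I-block, as
    \<open>girth\<close> demands. They fit because there are at least \<open>9 * r * Suc k\<close>
    blocks; \<open>Suc k\<close> keeps the ring nonempty.\<close>
  define t where "t k i \<longleftrightarrow> i < 2 * (4 * r * Suc k) \<and> odd i" for k i :: nat
  have len: "9 * (r * Suc k) \<le> n k" for k
    using mult_right_mono[OF p, of "Suc k"] by (simp only: n_def mult.assoc)
  have pos: "0 < r * Suc k" for k using q(2) by simp
  have ring: "block_ring (n k)" for k
    using len[of k] pos[of k] by unfold_locales linarith
  have sep: "\<not> t k (block_ring.nx (n k) i)" if "i < n k" "t k i" for k i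
    using that unfolding block_ring.nx_def[OF ring] t_def by auto
  have "{i. i < n k \<and> t k i} = {i. i < 2 * (4 * r * Suc k) \<and> odd i}" for k
  proof -
    have "2 * (4 * r * Suc k) \<le> n k" using len[of k] by (simp only: mult.assoc)
    then show ?thesis by (auto simp: t_def)
  qed
  then have h: "card {i. i < n k \<and> t k i} = 4 * r * Suc k" for k
    by (simp only: card_odd_less)
  let ?V = "\<lambda>k. block_ring.V (n k) (t k)" and ?E = "\<lambda>k. block_ring.E (n k) (t k)"
  have cV: "card (?V k) = 8 * q * Suc k" for k
    unfolding block_ring.card_V[OF ring] h by (simp add: n_def q algebra_simps)
  have cE: "card (?E k) = 12 * q * Suc k" for k
    unfolding block_ring.card_E[OF ring] h by (simp add: n_def q algebra_simps)
  have props: "cubic_graph (?V k) (?E k) \<and> bridgeless (?V k) (?E k) \<and> cyclically_connected 4 (?V k) (?E k) \<and>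
      girth (?V k) (?E k) = 5 \<and> m3 (?V k) (?E k) = real p / real q" for k
  proof -
    have "m3 (?V k) (?E k) = 1 - 3 * real (4 * r * Suc k) / real (12 * q * Suc k)"
      using block_ring.m3[OF ring, of k "t k"] sep unfolding h cE by blast
    also have "3 * real (4 * r * Suc k) / real (12 * q * Suc k) = (12 * real (Suc k) * real r) / (12 * real (Suc k) * real q)"
      by (simp only: of_nat_mult of_nat_numeral mult.assoc mult.commute mult.left_commute)
    also have "\<dots> = real r / real q" by (rule mult_divide_mult_cancel_left) simp
    also have "1 - \<dots> = real p / real q" using assms(1) q by (simp add: field_simps)
    finally have "m3 (?V k) (?E k) = real p / real q" .
    moreover have "\<not> t k 0" by (simp add: t_def)
    ultimately show ?thesis
      using block_ring.cubic[OF ring] block_ring.bridgeless[OF ring]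
        block_ring.cyclically_4_connected[OF ring] block_ring.girth[OF ring] by blast
  qed
  have iso: "k = l" if "graph_iso (?V k, ?E k) (?V l, ?E l)" for k l
    using graph_iso_card[OF that] assms(1) unfolding cV by simp
  \<comment> \<open>Equal graphs are isomorphic, so \<open>iso\<close>, which compares the orders
    \<open>8 * q * Suc k\<close>, also yields injectivity.\<close>
  have "graph_iso G G" for G by (auto simp: graph_iso_def intro!: exI[of _ id])
  then have "inj (\<lambda>k. (?V k, ?E k))" using iso unfolding inj_def by metis
  then have "infinite (range (\<lambda>k. (?V k, ?E k)))" by (rule range_inj_infinite)
  then show ?thesis using props iso by (intro exI[of _ "range (\<lambda>k. (?V k, ?E k))"]) auto
qed

end
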